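(* For $g=\begin{pmatrix} a & b \\ c & d \end{pmatrix}\in\mathrm{GL}_2(\mathbb C)$ set $$\hat g=\frac1{\det g}\begin{pmatrix} d^2 & -cd & c^2 \\ -2bd & bc+ad & -2ac \\ b^2 & -ab & a^2 \end{pmatrix}.$$ The group $\mathrm{GL}_2\times\mathrm{GL}_2$ acts on the affine variety $\Upsilon_{\mathbb A}^{14}$ by the following rule (coordinates not mentioned are left unchanged). • For $g$ in the first factor: $$\begin{pmatrix} t_2 & t_3 & t_4 \\ s_2 & s_3 & s_4 \end{pmatrix}\mapsto\begin{pmatrix} t_2 & t_3 & t_4 \\ s_2 & s_3 & s_4 \end{pmatrix}\hat g,\quad \begin{pmatrix} x_1 & x_2 \\ y_1 & y_2 \end{pmatrix}\mapsto\begin{pmatrix} x_1 & x_2 \\ y_1 & y_2 \end{pmatrix}g,\quad (p_1\ p_2\ p_3\ p_4)\mapsto\det g\,(p_1\ p_2\ p_3\ p_4).$$ • For $h$ in the second factor: $$\begin{pmatrix} t_1 & t_2 & t_3 & t_4 \\ s_1 & s_2 & s_3 & s_4 \end{pmatrix}\mapsto h\begin{pmatrix} t_1 & t_2 & t_3 & t_4 \\ s_1 & s_2 & s_3 & s_4 \end{pmatrix},\quad\begin{pmatrix} p_2 \\ p_4 \end{pmatrix}\mapsto h\begin{pmatrix} p_2 \\ p_4 \end{pmatrix},\quad p_1\mapsto\det h\,p_1,\quad p_3\mapsto\det h\,p_3.$$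
   Context: Over $\mathbb C$. A rule written by right multiplication by $g$ is understood as a right action on points (equivalently a left action through $g^{-1}$). **Definition of $\Upsilon_{\mathbb A}^{14}$.** $\mathbb A_\Upsilon$ is the affine $18$-space with coordinates $u,x_1,x_2,y_1,y_2,p_1,p_2,p_3,p_4$ and $z,s_1,\dots,s_4,t_1,\dots,t_4$. Put $\mathsf{ST}_{ij}=s_it_j-s_jt_i$. $\Upsilon_{\mathbb A}^{14}$ is the closed subscheme defined by the vanishing of the nine polynomials $p_1^\sharp=-up_1-\big(x_1^2\mathsf{ST}_{12}+2x_1x_2\mathsf{ST}_{13}+x_2^2\mathsf{ST}_{14}+2x_1y_1\mathsf{ST}_{23}+(x_1y_2+x_2y_1)\mathsf{ST}_{24}+2x_2y_2\mathsf{ST}_{34}\big)$, $p_2^\sharp=-up_2+t_1(x_2y_1-x_1y_2)+t_2(y_1^2-zx_1^2)+2t_3(y_1y_2-zx_1x_2)+t_4(y_2^2-zx_2^2)$, $p_3^\sharp=up_3-\big(x_1y_1\mathsf{ST}_{12}+(x_1y_2+x_2y_1)\mathsf{ST}_{13}+x_2y_2\mathsf{ST}_{14}+(y_1^2+zx_1^2)\mathsf{ST}_{23}+(y_1y_2+zx_1x_2)\mathsf{ST}_{24}+(y_2^2+zx_2^2)\mathsf{ST}_{34}\big)$, $p_4^\sharp=-up_4+s_1(x_2y_1-x_1y_2)+s_2(y_1^2-zx_1^2)+2s_3(y_1y_2-zx_1x_2)+s_4(y_2^2-zx_2^2)$, $x_1^\sharp=-p_1y_1-p_3x_1+(p_2s_3-p_4t_3)x_1+(p_2s_4-p_4t_4)x_2$,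 $x_2^\sharp=-p_1y_2-p_3x_2-(p_2s_2-p_4t_2)x_1-(p_2s_3-p_4t_3)x_2$, $y_1^\sharp=(-zp_1+p_2s_1-p_4t_1)x_1-p_3y_1-(p_2s_3-p_4t_3)y_1-(p_2s_4-p_4t_4)y_2$, $y_2^\sharp=(-zp_1+p_2s_1-p_4t_1)x_2-p_3y_2+(p_2s_2-p_4t_2)y_1+(p_2s_3-p_4t_3)y_2$, $u^\sharp=-zp_1^2+p_1(p_2s_1-p_4t_1)+p_3^2-(p_2s_3-p_4t_3)^2+(p_2s_2-p_4t_2)(p_2s_4-p_4t_4)$. *)

theory Defs
  imports
    "HOL-Analysis.Analysis"
    "HOL-Algebra.Group_Action"
    "HOL-Library.Poly_Mapping"
begin

section \<open>Affine 18-space and its polynomial ring over the complex numbers\<close>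

datatype ups_coord =
  U | X1 | X2 | Y1 | Y2 | P1 | P2 | P3 | P4 | Z | S1 | S2 | S3 | S4 | T1 | T2 | T3 | T4

text \<open>
  A monomial is a finitely supported map from coordinates to exponents; a polynomial is a finitely
  supported map from monomials to coefficients, with the convolution product of
  \<^theory>\<open>HOL-Library.Poly_Mapping\<close>.
\<close>
type_synonym ups_poly = "(ups_coord \<Rightarrow>\<^sub>0 nat) \<Rightarrow>\<^sub>0 complex"

definition pvar :: "ups_coord \<Rightarrow> ups_poly" where
  "pvar c = Poly_Mapping.single (Poly_Mapping.single c 1) 1"

text \<open>
  A commutative algebra over the complex numbers is a commutative ring \<open>R\<close> together with its
  structure homomorphism \<open>\<iota>\<close>.
\<close>
definition unital_ring_hom :: "('a::comm_ring_1 \<Rightarrow> 'b::comm_ring_1) \<Rightarrow> bool" where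
  "unital_ring_hom f \<longleftrightarrow>
     f 1 = 1 \<and> (\<forall>x y. f (x + y) = f x + f y) \<and> (\<forall>x y. f (x * y) = f x * f y)"

definition complex_algebra :: "(complex \<Rightarrow> 'r::comm_ring_1) \<Rightarrow> bool" where
  "complex_algebra \<iota> \<longleftrightarrow> unital_ring_hom \<iota>"

definition complex_algebra_hom ::
    "(complex \<Rightarrow> 'r::comm_ring_1) \<Rightarrow> (complex \<Rightarrow> 's::comm_ring_1) \<Rightarrow> ('r \<Rightarrow> 's) \<Rightarrow> bool" where
  "complex_algebra_hom \<iota> \<kappa> \<phi> \<longleftrightarrow> unital_ring_hom \<phi> \<and> (\<forall>c. \<phi> (\<iota> c) = \<kappa> c)"

definition peval :: "(complex \<Rightarrow> 'r::comm_ring_1) \<Rightarrow> (ups_coord \<Rightarrow> 'r) \<Rightarrow> ups_poly \<Rightarrow> 'r" where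
  "peval \<iota> v f =
     (\<Sum>m\<in>Poly_Mapping.keys f. \<iota> (Poly_Mapping.lookup f m) *
        (\<Prod>c\<in>Poly_Mapping.keys m. v c ^ Poly_Mapping.lookup m c))"

section \<open>The nine defining polynomials\<close>

context
begin

private abbreviation (input) "u \<equiv> pvar U"
private abbreviation (input) "z \<equiv> pvar Z"
private abbreviation (input) "x\<^sub>1 \<equiv> pvar X1"
private abbreviation (input) "x\<^sub>2 \<equiv> pvar X2"
private abbreviation (input) "y\<^sub>1 \<equiv> pvar Y1"
private abbreviation (input) "y\<^sub>2 \<equiv> pvar Y2"
private abbreviation (input) "p\<^sub>1 \<equiv> pvar P1"
private abbreviation (input) "p\<^sub>2 \<equiv> pvar P2"
private abbreviation (input) "p\<^sub>3 \<equiv> pvar P3"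
private abbreviation (input) "p\<^sub>4 \<equiv> pvar P4"
private abbreviation (input) "s\<^sub>1 \<equiv> pvar S1"
private abbreviation (input) "s\<^sub>2 \<equiv> pvar S2"
private abbreviation (input) "s\<^sub>3 \<equiv> pvar S3"
private abbreviation (input) "s\<^sub>4 \<equiv> pvar S4"
private abbreviation (input) "t\<^sub>1 \<equiv> pvar T1"
private abbreviation (input) "t\<^sub>2 \<equiv> pvar T2"
private abbreviation (input) "t\<^sub>3 \<equiv> pvar T3"
private abbreviation (input) "t\<^sub>4 \<equiv> pvar T4"

private abbreviation (input) "ST\<^sub>1\<^sub>2 \<equiv> s\<^sub>1 * t\<^sub>2 - s\<^sub>2 * t\<^sub>1"
private abbreviation (input) "ST\<^sub>1\<^sub>3 \<equiv> s\<^sub>1 * t\<^sub>3 - s\<^sub>3 * t\<^sub>1"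
private abbreviation (input) "ST\<^sub>1\<^sub>4 \<equiv> s\<^sub>1 * t\<^sub>4 - s\<^sub>4 * t\<^sub>1"
private abbreviation (input) "ST\<^sub>2\<^sub>3 \<equiv> s\<^sub>2 * t\<^sub>3 - s\<^sub>3 * t\<^sub>2"
private abbreviation (input) "ST\<^sub>2\<^sub>4 \<equiv> s\<^sub>2 * t\<^sub>4 - s\<^sub>4 * t\<^sub>2"
private abbreviation (input) "ST\<^sub>3\<^sub>4 \<equiv> s\<^sub>3 * t\<^sub>4 - s\<^sub>4 * t\<^sub>3"

definition p1_sharp :: ups_poly where
  "p1_sharp = - u * p\<^sub>1
     - (x\<^sub>1^2 * ST\<^sub>1\<^sub>2 + 2 * x\<^sub>1 * x\<^sub>2 * ST\<^sub>1\<^sub>3 + x\<^sub>2^2 * ST\<^sub>1\<^sub>4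
        + 2 * x\<^sub>1 * y\<^sub>1 * ST\<^sub>2\<^sub>3 + (x\<^sub>1 * y\<^sub>2 + x\<^sub>2 * y\<^sub>1) * ST\<^sub>2\<^sub>4 + 2 * x\<^sub>2 * y\<^sub>2 * ST\<^sub>3\<^sub>4)"

definition p2_sharp :: ups_poly where
  "p2_sharp = - u * p\<^sub>2 + t\<^sub>1 * (x\<^sub>2 * y\<^sub>1 - x\<^sub>1 * y\<^sub>2) + t\<^sub>2 * (y\<^sub>1^2 - z * x\<^sub>1^2)
     + 2 * t\<^sub>3 * (y\<^sub>1 * y\<^sub>2 - z * x\<^sub>1 * x\<^sub>2) + t\<^sub>4 * (y\<^sub>2^2 - z * x\<^sub>2^2)"

definition p3_sharp :: ups_poly where
  "p3_sharp = u * p\<^sub>3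
     - (x\<^sub>1 * y\<^sub>1 * ST\<^sub>1\<^sub>2 + (x\<^sub>1 * y\<^sub>2 + x\<^sub>2 * y\<^sub>1) * ST\<^sub>1\<^sub>3 + x\<^sub>2 * y\<^sub>2 * ST\<^sub>1\<^sub>4
        + (y\<^sub>1^2 + z * x\<^sub>1^2) * ST\<^sub>2\<^sub>3 + (y\<^sub>1 * y\<^sub>2 + z * x\<^sub>1 * x\<^sub>2) * ST\<^sub>2\<^sub>4
        + (y\<^sub>2^2 + z * x\<^sub>2^2) * ST\<^sub>3\<^sub>4)"

definition p4_sharp :: ups_poly where
  "p4_sharp = - u * p\<^sub>4 + s\<^sub>1 * (x\<^sub>2 * y\<^sub>1 - x\<^sub>1 * y\<^sub>2) + s\<^sub>2 * (y\<^sub>1^2 - z * x\<^sub>1^2)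
     + 2 * s\<^sub>3 * (y\<^sub>1 * y\<^sub>2 - z * x\<^sub>1 * x\<^sub>2) + s\<^sub>4 * (y\<^sub>2^2 - z * x\<^sub>2^2)"

definition x1_sharp :: ups_poly where
  "x1_sharp = - p\<^sub>1 * y\<^sub>1 - p\<^sub>3 * x\<^sub>1 + (p\<^sub>2 * s\<^sub>3 - p\<^sub>4 * t\<^sub>3) * x\<^sub>1 + (p\<^sub>2 * s\<^sub>4 - p\<^sub>4 * t\<^sub>4) * x\<^sub>2"

definition x2_sharp :: ups_poly where
  "x2_sharp = - p\<^sub>1 * y\<^sub>2 - p\<^sub>3 * x\<^sub>2 - (p\<^sub>2 * s\<^sub>2 - p\<^sub>4 * t\<^sub>2) * x\<^sub>1 - (p\<^sub>2 * s\<^sub>3 - p\<^sub>4 * t\<^sub>3) * x\<^sub>2"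

definition y1_sharp :: ups_poly where
  "y1_sharp = (- z * p\<^sub>1 + p\<^sub>2 * s\<^sub>1 - p\<^sub>4 * t\<^sub>1) * x\<^sub>1 - p\<^sub>3 * y\<^sub>1
     - (p\<^sub>2 * s\<^sub>3 - p\<^sub>4 * t\<^sub>3) * y\<^sub>1 - (p\<^sub>2 * s\<^sub>4 - p\<^sub>4 * t\<^sub>4) * y\<^sub>2"

definition y2_sharp :: ups_poly where
  "y2_sharp = (- z * p\<^sub>1 + p\<^sub>2 * s\<^sub>1 - p\<^sub>4 * t\<^sub>1) * x\<^sub>2 - p\<^sub>3 * y\<^sub>2
     + (p\<^sub>2 * s\<^sub>2 - p\<^sub>4 * t\<^sub>2) * y\<^sub>1 + (p\<^sub>2 * s\<^sub>3 - p\<^sub>4 * t\<^sub>3) * y\<^sub>2"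

definition u_sharp :: ups_poly where
  "u_sharp = - z * p\<^sub>1^2 + p\<^sub>1 * (p\<^sub>2 * s\<^sub>1 - p\<^sub>4 * t\<^sub>1) + p\<^sub>3^2 - (p\<^sub>2 * s\<^sub>3 - p\<^sub>4 * t\<^sub>3)^2
     + (p\<^sub>2 * s\<^sub>2 - p\<^sub>4 * t\<^sub>2) * (p\<^sub>2 * s\<^sub>4 - p\<^sub>4 * t\<^sub>4)"

end

text \<open>
  The closed subscheme is given by its functor of points: for a complex algebra \<open>\<iota>\<close> with underlying
  ring \<open>R\<close>, the set \<open>Upsilon14 \<iota>\<close> consists of the \<open>R\<close>-valued points, i.e. the common zeros in
  \<open>R\<close>-valued affine 18-space. For \<open>R\<close> the complex numbers and \<open>\<iota>\<close> the identity these are the closed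
  points. Working over all \<open>R\<close> retains the scheme structure (no reducedness is presupposed).
\<close>
definition Upsilon14 :: "(complex \<Rightarrow> 'r::comm_ring_1) \<Rightarrow> (ups_coord \<Rightarrow> 'r) set" where
  "Upsilon14 \<iota> = {v. \<forall>f \<in> {p1_sharp, p2_sharp, p3_sharp, p4_sharp,
      x1_sharp, x2_sharp, y1_sharp, y2_sharp, u_sharp}. peval \<iota> v f = 0}"

section \<open>The general linear group and the transformation rules\<close>

definition GL2 :: "('r::comm_ring_1^2^2) monoid" where
  "GL2 = \<lparr>carrier = {g. invertible g}, mult = (**), one = mat 1\<rparr>"

text \<open>The inverse of a unit of a commutative ring; over the complex numbers, \<open>1 / a\<close> for \<open>a \<noteq> 0\<close>.\<close>
definition unit_inverse :: "'r::comm_ring_1 \<Rightarrow> 'r" where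
  "unit_inverse a = (THE b. a * b = 1)"

definition ghat :: "'r::comm_ring_1^2^2 \<Rightarrow> 'r^3^3" where
  "ghat g =
     (let a = g$1$1; b = g$1$2; c = g$2$1; d = g$2$2;
          M = vector [vector [d^2,          - (c * d),     c^2],
                      vector [- (2 * b * d), b * c + a * d, - (2 * a * c)],
                      vector [b^2,          - (a * b),     a^2]] :: 'r^3^3
      in \<chi> i j. unit_inverse (det g) * M$i$j)"

definition first_rule :: "'r::comm_ring_1^2^2 \<Rightarrow> (ups_coord \<Rightarrow> 'r) \<Rightarrow> (ups_coord \<Rightarrow> 'r)" where
  "first_rule g v =
     (let A = (vector [vector [v T2, v T3, v T4],
                       vector [v S2, v S3, v S4]] :: 'r^3^2) ** ghat g;
          B = (vector [vector [v X1, v X2],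
                       vector [v Y1, v Y2]] :: 'r^2^2) ** g
      in v(T2 := A$1$1, T3 := A$1$2, T4 := A$1$3,
           S2 := A$2$1, S3 := A$2$2, S4 := A$2$3,
           X1 := B$1$1, X2 := B$1$2,
           Y1 := B$2$1, Y2 := B$2$2,
           P1 := det g * v P1, P2 := det g * v P2, P3 := det g * v P3, P4 := det g * v P4))"

definition second_rule :: "'r::comm_ring_1^2^2 \<Rightarrow> (ups_coord \<Rightarrow> 'r) \<Rightarrow> (ups_coord \<Rightarrow> 'r)" where
  "second_rule h v =
     (let A = h ** (vector [vector [v T1, v T2, v T3, v T4],
                            vector [v S1, v S2, v S3, v S4]] :: 'r^4^2);
          q = h *v (vector [v P2, v P4] :: 'r^2)
      in v(T1 := A$1$1, T2 := A$1$2, T3 := A$1$3, T4 := A$1$4,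
           S1 := A$2$1, S2 := A$2$2, S3 := A$2$3, S4 := A$2$4,
           P2 := q$1, P4 := q$2,
           P1 := det h * v P1, P3 := det h * v P3))"

text \<open>
  The first rule is a right action, so it enters the left action of the product through \<open>g\<inverse>\<close>.
  By Yoneda, an action of the group scheme on the affine scheme is the same as an action of the group
  of \<open>R\<close>-valued points on \<open>Upsilon14 \<iota>\<close> for each complex algebra, compatible with algebra
  homomorphisms; this compatibility is what makes the action algebraic. (Since \<open>0 \<noteq> 1\<close> in the class
  \<open>comm_ring_1\<close>, the zero ring is left out; over it all point sets are singletons.)
\<close>
definition ups_act :: "('r::comm_ring_1^2^2) \<times> ('r^2^2) \<Rightarrow> (ups_coord \<Rightarrow> 'r) \<Rightarrow> (ups_coord \<Rightarrow> 'r)" where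
  "ups_act = (\<lambda>(g, h) v. second_rule h (first_rule (inv\<^bsub>GL2\<^esub> g) v))"

end

theory Submission
  imports Defs
begin

text \<open>
  The nine equations are invariants of \<open>GL\<^sub>2 \<times> GL\<^sub>2\<close> in disguise. Read \<open>x = (x\<^sub>1, x\<^sub>2)\<close> and
  \<open>y = (y\<^sub>1, y\<^sub>2)\<close> as row vectors, and \<open>s = (s\<^sub>2, s\<^sub>3, s\<^sub>4)\<close>, \<open>t = (t\<^sub>2, t\<^sub>3, t\<^sub>4)\<close> as the
  coefficients of binary quadratic forms \<open>s\<^sub>2 X\<^sup>2 + 2 s\<^sub>3 X Y + s\<^sub>4 Y\<^sup>2\<close>. The matrix \<open>ghat g\<close> is the change
  of coefficients for which the value of a form at a vector gets multiplied by \<open>det g\<close> when the vector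
  is multiplied by \<open>g\<close> on the right. Every equation can be written with five constructions of classical
  invariant theory: the polar bilinear form \<open>bilin\<close>, the discriminant \<open>disc\<close>, the Hamiltonian vector
  field \<open>hamil\<close> of a form, the Jacobian \<open>jacob\<close> of two forms, and the area \<open>area\<close> of two vectors
  (\<open>Upsilon14_iff\<close>). These are covariant under the first factor: the lemmas \<open>bilin_ghat\<close>,
  \<open>disc_ghat\<close>, \<open>hamil_ghat\<close>, \<open>jacob_ghat\<close>, \<open>area_mult\<close> say by which power of \<open>det g\<close>.
  The second factor replaces the pair \<open>(t, s)\<close> by linear combinations, under which \<open>bilin\<close> is linear and
  \<open>jacob\<close>, being alternating in the two forms, is multiplied by \<open>det h\<close>.

  Hence each equation, or pair of equations forming a vector, is sent to an invertible linear image of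
  itself (\<open>first_rule_values\<close>, \<open>second_rule_values\<close>), so both rules preserve the set of
  points over every algebra. The group laws reduce to the multiplicativity of \<open>ghat\<close> and of the
  determinant, together with the fact that left and right multiplications commute; as
  \<open>first_rule\<close> is a right action, inverting \<open>g\<close> makes it a left one. Finally, all formulas
  are polynomials in the entries and in \<open>1 / det g\<close>, whence the compatibility with algebra homomorphisms.

  No division other than by \<open>det g\<close> may occur, because the points have coordinates in an arbitrary ring:
  each covariance law is a polynomial identity between the entries of \<open>g\<close> and an extra variable
  \<open>e = unit_inverse (det g)\<close> that enters through powers of \<open>det g * e\<close> alone.
\<close>

section \<open>Homomorphisms and evaluation of polynomials\<close>

lemma unital_ring_hom_simps:
  assumes "unital_ring_hom f"
  shows "f 0 = 0" "f 1 = 1" "f (x + y) = f x + f y" "f (x * y) = f x * f y"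
    "f (- x) = - f x" "f (x - y) = f x - f y" "f (x ^ n) = f x ^ n"
    "f 2 = 2"
proof -
  have add: "f (a + b) = f a + f b" and mult: "f (a * b) = f a * f b" and one: "f 1 = 1" for a b
    using assms by (auto simp: unital_ring_hom_def)
  show zero: "f 0 = 0"
    using add[of 0 0] by simp
  have neg: "f (- a) = - f a" for a
    using add[of a "- a"] zero by (simp add: eq_neg_iff_add_eq_0 add.commute)
  show "f 1 = 1" "f (x + y) = f x + f y" "f (x * y) = f x * f y" "f (- x) = - f x"
    by (fact one add mult neg)+
  show "f (x - y) = f x - f y"
    using add[of x "- y"] neg[of y] by simp
  show "f (x ^ n) = f x ^ n"
    by (induction n) (simp_all add: one mult)
  show "f 2 = 2"
    using add[of 1 1] one by simp
qed

lemma unital_ring_hom_sum: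
  assumes "unital_ring_hom f"
  shows "f (sum g A) = (\<Sum>a\<in>A. f (g a))"
  by (induction A rule: infinite_finite_induct) (simp_all add: unital_ring_hom_simps[OF assms])

lemma unital_ring_hom_prod:
  assumes "unital_ring_hom f"
  shows "f (prod g A) = (\<Prod>a\<in>A. f (g a))"
  by (induction A rule: infinite_finite_induct) (simp_all add: unital_ring_hom_simps[OF assms])

lemma peval_hom:
  assumes "complex_algebra_hom \<iota> \<kappa> \<phi>"
  shows "\<phi> (peval \<iota> v f) = peval \<kappa> (\<phi> \<circ> v) f"
proof -
  have "unital_ring_hom \<phi>" "\<And>c. \<phi> (\<iota> c) = \<kappa> c"
    using assms by (auto simp: complex_algebra_hom_def)
  then show ?thesis
    by (simp add: peval_def unital_ring_hom_sum unital_ring_hom_prod unital_ring_hom_simps)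
qed

definition monomial_eval :: "('i \<Rightarrow> 'r::comm_ring_1) \<Rightarrow> ('i \<Rightarrow>\<^sub>0 nat) \<Rightarrow> 'r" where
  "monomial_eval v m = (\<Prod>c\<in>Poly_Mapping.keys m. v c ^ Poly_Mapping.lookup m c)"

lemma monomial_eval_add: "monomial_eval v (m + n) = monomial_eval v m * monomial_eval v n"
proof -
  have superset: "monomial_eval v k = (\<Prod>c\<in>A. v c ^ Poly_Mapping.lookup k c)"
    if "finite A" "Poly_Mapping.keys k \<subseteq> A" for k A
    unfolding monomial_eval_def using that
    by (intro prod.mono_neutral_left) (auto simp: in_keys_iff)
  let ?A = "Poly_Mapping.keys m \<union> Poly_Mapping.keys n"
  have "monomial_eval v k = (\<Prod>c\<in>?A. v c ^ Poly_Mapping.lookup k c)" if "k \<in> {m, n, m + n}" for k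
    using that by (intro superset) (auto dest: subsetD[OF Poly_Mapping.keys_add])
  then show ?thesis
    by (simp add: lookup_add power_add prod.distrib)
qed

text \<open>
  Polynomials are sums of terms, so a property of polynomials that is stable under adding one term holds
  for all of them. Additivity of evaluation thus reduces its multiplicativity to a product of two terms.
\<close>
lemma poly_mapping_single_add_induct [case_names zero single_add]:
  assumes "P 0" "\<And>m a f. P f \<Longrightarrow> P (Poly_Mapping.single m a + f)"
  shows "P (f :: 'a \<Rightarrow>\<^sub>0 'b::comm_monoid_add)"
proof (induction f rule: Poly_Mapping.update_induct)
  case const
  then show ?case by (rule assms(1))
next
  case (update f m a)
  have "Poly_Mapping.update m a f = Poly_Mapping.single m a + f"
    using update(1) by (intro poly_mapping_eqI)
      (auto simp: lookup_update lookup_add lookup_single when_def in_keys_iff)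
  then show ?case using assms(2)[OF update(3)] by simp
qed

context
  fixes \<iota> :: "complex \<Rightarrow> 'r::comm_ring_1" and v :: "ups_coord \<Rightarrow> 'r"
  assumes \<iota>: "complex_algebra \<iota>"
begin

lemmas \<iota>_simps = unital_ring_hom_simps[OF \<iota>[unfolded complex_algebra_def]]

text \<open>
  The range of summation in \<open>peval\<close> depends on the polynomial; a common larger range is what allows two
  polynomials to be compared term by term.
\<close>
lemma peval_superset:
  assumes "finite A" "Poly_Mapping.keys f \<subseteq> A"
  shows "peval \<iota> v f = (\<Sum>m\<in>A. \<iota> (Poly_Mapping.lookup f m) * monomial_eval v m)"
  unfolding peval_def monomial_eval_def[symmetric] using assms
  by (intro sum.mono_neutral_left) (auto simp: in_keys_iff \<iota>_simps)

lemma peval_add: "peval \<iota> v (f + g) = peval \<iota> v f + peval \<iota> v g"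
proof -
  let ?A = "Poly_Mapping.keys f \<union> Poly_Mapping.keys g"
  have "peval \<iota> v h = (\<Sum>m\<in>?A. \<iota> (Poly_Mapping.lookup h m) * monomial_eval v m)"
    if "h \<in> {f, g, f + g}" for h
    using that by (intro peval_superset) (auto dest: subsetD[OF Poly_Mapping.keys_add])
  then show ?thesis
    by (simp add: lookup_add \<iota>_simps distrib_right sum.distrib)
qed

lemma peval_single: "peval \<iota> v (Poly_Mapping.single m a) = \<iota> a * monomial_eval v m"
  by (subst peval_superset[of "{m}"]) (auto simp: \<iota>_simps split: if_splits)

lemma peval_zero: "peval \<iota> v 0 = 0"
  by (simp add: peval_def)

lemma peval_mult: "peval \<iota> v (f * g) = peval \<iota> v f * peval \<iota> v g"
proof (induction f rule: poly_mapping_single_add_induct)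
  case zero
  show ?case by (simp add: peval_zero)
next
  case (single_add m a f)
  have "peval \<iota> v (Poly_Mapping.single m a * g) = \<iota> a * monomial_eval v m * peval \<iota> v g"
  proof (induction g rule: poly_mapping_single_add_induct)
    case zero
    show ?case by (simp add: peval_zero)
  next
    case (single_add n b g)
    then show ?case
      by (simp add: distrib_left peval_add mult_single peval_single monomial_eval_add \<iota>_simps mult_ac)
  qed
  with single_add show ?case
    by (simp add: distrib_right peval_add peval_single)
qed

lemma unital_ring_hom_peval: "unital_ring_hom (peval \<iota> v)"
  unfolding unital_ring_hom_def
  using peval_single[of 0 1] by (simp add: peval_add peval_mult \<iota>_simps monomial_eval_def)

lemma peval_pvar: "peval \<iota> v (pvar c) = v c"
  by (simp add: pvar_def peval_single \<iota>_simps monomial_eval_def)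

end

section \<open>Binary quadratic forms\<close>

text \<open>
  A vector \<open>q\<close> of length three stands for the form \<open>Q = q\<^sub>1 X\<^sup>2 + 2 q\<^sub>2 X Y + q\<^sub>3 Y\<^sup>2\<close>. This is its polar
  form, so that \<open>bilin q a a\<close> is the value of \<open>Q\<close> at \<open>a\<close>.
\<close>
definition bilin :: "'r::comm_ring_1^3 \<Rightarrow> 'r^2 \<Rightarrow> 'r^2 \<Rightarrow> 'r" where
  "bilin q a b = q$1 * (a$1 * b$1) + q$2 * (a$1 * b$2 + a$2 * b$1) + q$3 * (a$2 * b$2)"

text \<open>
  A quarter of the usual discriminant of \<open>Q\<close>, that is, minus the determinant of its Gram matrix.
\<close>
definition disc :: "'r::comm_ring_1^3 \<Rightarrow> 'r" where
  "disc q = (q$2)^2 - q$1 * q$3"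

text \<open>
  The Hamiltonian vector field of \<open>Q / 2\<close> for the area form: half of \<open>(\<partial>Q/\<partial>Y, - \<partial>Q/\<partial>X)\<close> at the
  point \<open>a\<close>. It is given by a traceless matrix, whose determinant is minus the discriminant \<open>disc q\<close>.
\<close>
definition hamil :: "'r::comm_ring_1^3 \<Rightarrow> 'r^2 \<Rightarrow> 'r^2" where
  "hamil q a = vector [q$2 * a$1 + q$3 * a$2, - (q$1 * a$1) - q$2 * a$2]"

text \<open>
  A quarter of the Jacobian determinant of the forms of \<open>q\<close> and \<open>r\<close> at the point \<open>a\<close>. It is a
  quadratic form in \<open>a\<close>, and the two-by-two minors of the rows \<open>q\<close> and \<open>r\<close> are its coefficients.
\<close>
definition jacob :: "'r::comm_ring_1^3 \<Rightarrow> 'r^3 \<Rightarrow> 'r^2 \<Rightarrow> 'r" where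
  "jacob q r a = (q$1 * r$2 - q$2 * r$1) * (a$1)^2 + (q$1 * r$3 - q$3 * r$1) * (a$1 * a$2)
     + (q$2 * r$3 - q$3 * r$2) * (a$2)^2"

definition area :: "'r::comm_ring_1^2 \<Rightarrow> 'r^2 \<Rightarrow> 'r" where
  "area a b = a$1 * b$2 - a$2 * b$1"

lemma unit_inverse_eq: "a * b = 1 \<Longrightarrow> unit_inverse a = b"
  unfolding unit_inverse_def
  by (rule the_equality) (metis mult.commute mult.left_commute mult.right_neutral)+

lemma det_unit:
  fixes g :: "'r::comm_ring_1^'n^'n"
  assumes "invertible g"
  shows "det g * unit_inverse (det g) = 1"
proof -
  obtain g' where "g ** g' = mat 1"
    using assms by (auto simp: invertible_def)
  then have "det g * det g' = 1"
    by (metis det_mul det_I)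
  then show ?thesis
    using unit_inverse_eq by metis
qed

lemma row_ghat:
  "(q v* ghat g) $ 1 = unit_inverse (det g) * (q$1 * (g$2$2)^2 - 2 * q$2 * g$1$2 * g$2$2 + q$3 * (g$1$2)^2)"
  "(q v* ghat g) $ 2 = unit_inverse (det g) *
      (- (q$1 * g$2$1 * g$2$2) + q$2 * (g$1$2 * g$2$1 + g$1$1 * g$2$2) - q$3 * g$1$1 * g$1$2)"
  "(q v* ghat g) $ 3 = unit_inverse (det g) * (q$1 * (g$2$1)^2 - 2 * q$2 * g$1$1 * g$2$1 + q$3 * (g$1$1)^2)"
  by (simp_all add: ghat_def Let_def vector_matrix_mult_def sum_3 algebra_simps)

lemma row_mult_2:
  "(a v* (g :: 'r::comm_ring_1^2^2)) $ j = a$1 * g$1$j + a$2 * g$2$j"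
  by (simp add: vector_matrix_mult_def sum_2)

lemma area_mult: "area (a v* g) (b v* g) = det g * area a b"
  by (simp add: area_def row_mult_2 det_2 algebra_simps)

text \<open>
  The entries of \<open>ghat g\<close> are those of the symmetric square of the inverse of \<open>g\<close>, multiplied by
  \<open>det g\<close>. The inverse matrices cancel the factors \<open>g\<close> on the vectors, and a single \<open>det g\<close> is left.
\<close>
lemma bilin_ghat:
  assumes "invertible g"
  shows "bilin (q v* ghat g) (a v* g) (b v* g) = det g * bilin q a b"
proof -
  have "bilin (q v* ghat g) (a v* g) (b v* g)
      = (det g * unit_inverse (det g)) * (det g * bilin q a b)"
    by (simp add: bilin_def row_ghat row_mult_2) (simp add: det_2 algebra_simps power2_eq_square)
  then show ?thesis
    using det_unit[OF assms] by simp
qed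

text \<open>
  The Gram determinant changes by the square of the determinant of the substitution, here that of the
  inverse of \<open>g\<close>; the factor \<open>det g\<close> in the coefficients, squared as well, compensates for it exactly.
\<close>
lemma disc_ghat:
  assumes "invertible g"
  shows "disc (q v* ghat g) = disc q"
proof -
  have "disc (q v* ghat g) = (det g * unit_inverse (det g))^2 * disc q"
    by (simp add: disc_def row_ghat) (simp add: det_2 algebra_simps power2_eq_square)
  then show ?thesis
    using det_unit[OF assms] by simp
qed

text \<open>
  The vector \<open>hamil q a\<close> represents the functional \<open>bilin q a\<close> through the area form. Both pairings
  are multiplied by \<open>det g\<close>, so the representing vector is carried along by \<open>g\<close> without a factor.
\<close>
lemma hamil_ghat:
  assumes "invertible g"
  shows "hamil (q v* ghat g) (a v* g) = hamil q a v* g"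
proof -
  have "hamil (q v* ghat g) (a v* g) $ i = (det g * unit_inverse (det g)) * (hamil q a v* g) $ i" for i
    using exhaust_2[of i]
    by (auto simp add: hamil_def row_ghat row_mult_2; simp add: det_2 algebra_simps power2_eq_square)
  then show ?thesis
    using det_unit[OF assms] by (simp add: vec_eq_iff)
qed

text \<open>
  The Jacobian of two forms at \<open>a\<close> is the area of their two Hamiltonian vectors at \<open>a\<close>;
  those move with \<open>g\<close>, and areas are multiplied by \<open>det g\<close>.
\<close>
lemma jacob_ghat:
  assumes "invertible g"
  shows "jacob (q v* ghat g) (r v* ghat g) (a v* g) = det g * jacob q r a"
proof -
  have "jacob (q v* ghat g) (r v* ghat g) (a v* g)
      = (det g * unit_inverse (det g))^2 * (det g * jacob q r a)"
    by (simp add: jacob_def row_ghat row_mult_2) (simp add: det_2 algebra_simps power2_eq_square)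
  then show ?thesis
    using det_unit[OF assms] by simp
qed

lemma ghat_mult:
  assumes "invertible g" "invertible h"
  shows "ghat (g ** h) = ghat g ** ghat h"
proof -
  have "unit_inverse (det (g ** h)) = unit_inverse (det g) * unit_inverse (det h)"
    using det_unit[OF assms(1)] det_unit[OF assms(2)]
    by (intro unit_inverse_eq) (metis (no_types, lifting) det_mul mult.assoc mult.left_commute mult.right_neutral)
  then show ?thesis
    by (simp add: vec_eq_iff forall_3 ghat_def Let_def)
       (simp add: matrix_matrix_mult_def sum_3 sum_2 algebra_simps power2_eq_square)
qed

lemma ghat_one: "ghat (mat 1) = mat 1"
proof -
  have "unit_inverse (det (mat 1 :: 'a^2^2)) = (1 :: 'a::comm_ring_1)"
    by (intro unit_inverse_eq) simp
  then show ?thesis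
    by (simp add: vec_eq_iff forall_3 ghat_def Let_def mat_def)
qed

section \<open>The equations in invariant form\<close>

definition xrow :: "(ups_coord \<Rightarrow> 'r::comm_ring_1) \<Rightarrow> 'r^2" where
  "xrow v = vector [v X1, v X2]"

definition yrow :: "(ups_coord \<Rightarrow> 'r::comm_ring_1) \<Rightarrow> 'r^2" where
  "yrow v = vector [v Y1, v Y2]"

definition srow :: "(ups_coord \<Rightarrow> 'r::comm_ring_1) \<Rightarrow> 'r^3" where
  "srow v = vector [v S2, v S3, v S4]"

definition trow :: "(ups_coord \<Rightarrow> 'r::comm_ring_1) \<Rightarrow> 'r^3" where
  "trow v = vector [v T2, v T3, v T4]"

lemmas row_defs = xrow_def yrow_def srow_def trow_def

text \<open>
  The combinations \<open>r\<^sub>i = p\<^sub>2 s\<^sub>i - p\<^sub>4 t\<^sub>i\<close> are the only way in which \<open>s\<close> and \<open>t\<close> enter the last five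
  equations. The vector with \<open>i = 2, 3, 4\<close> is again a quadratic form; the scalar \<open>rhead\<close> is \<open>r\<^sub>1\<close>.
\<close>
definition rrow :: "(ups_coord \<Rightarrow> 'r::comm_ring_1) \<Rightarrow> 'r^3" where
  "rrow v = v P2 *s srow v - v P4 *s trow v"

definition rhead :: "(ups_coord \<Rightarrow> 'r::comm_ring_1) \<Rightarrow> 'r" where
  "rhead v = v P2 * v S1 - v P4 * v T1"

text \<open>
  The terms with \<open>2 x\<^sub>1 y\<^sub>1\<close>, \<open>x\<^sub>1 y\<^sub>2 + x\<^sub>2 y\<^sub>1\<close> and \<open>2 x\<^sub>2 y\<^sub>2\<close> are the polarization of the
  Jacobian. Written as a difference of values at \<open>x + y\<close>, \<open>x\<close> and \<open>y\<close>, it inherits the covariance of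
  \<open>jacob\<close> over every ring, even if two is not invertible.
\<close>
definition p1_value :: "(ups_coord \<Rightarrow> 'r::comm_ring_1) \<Rightarrow> 'r" where
  "p1_value v = - v U * v P1
     - (v S1 * bilin (trow v) (xrow v) (xrow v) - v T1 * bilin (srow v) (xrow v) (xrow v)
        + (jacob (srow v) (trow v) (xrow v + yrow v)
           - jacob (srow v) (trow v) (xrow v) - jacob (srow v) (trow v) (yrow v)))"

text \<open>
  The equations for \<open>p\<^sub>2\<close> and \<open>p\<^sub>4\<close> arise from one expression, linear in \<open>(p, q\<^sub>1, q)\<close>, at
  \<open>(p\<^sub>2, t\<^sub>1, t)\<close> and at \<open>(p\<^sub>4, s\<^sub>1, s)\<close>. By the linearity they form a column on which the second factor
  acts by \<open>h\<close>.
\<close>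
definition p24_value :: "'r::comm_ring_1 \<Rightarrow> 'r \<Rightarrow> 'r^3 \<Rightarrow> (ups_coord \<Rightarrow> 'r) \<Rightarrow> 'r" where
  "p24_value p q1 q v = - v U * p - q1 * area (xrow v) (yrow v)
     + bilin q (yrow v) (yrow v) - v Z * bilin q (xrow v) (xrow v)"

definition p3_value :: "(ups_coord \<Rightarrow> 'r::comm_ring_1) \<Rightarrow> 'r" where
  "p3_value v = v U * v P3
     - (v S1 * bilin (trow v) (xrow v) (yrow v) - v T1 * bilin (srow v) (xrow v) (yrow v)
        + jacob (srow v) (trow v) (yrow v) + v Z * jacob (srow v) (trow v) (xrow v))"

text \<open>
  The equations named after \<open>x\<^sub>1, x\<^sub>2\<close> form a row vector, as do those named after \<open>y\<^sub>1, y\<^sub>2\<close>; only as rows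
  are they covariant.
\<close>
definition x_value :: "(ups_coord \<Rightarrow> 'r::comm_ring_1) \<Rightarrow> 'r^2" where
  "x_value v = hamil (rrow v) (xrow v) - v P1 *s yrow v - v P3 *s xrow v"

definition y_value :: "(ups_coord \<Rightarrow> 'r::comm_ring_1) \<Rightarrow> 'r^2" where
  "y_value v = (rhead v - v Z * v P1) *s xrow v - v P3 *s yrow v - hamil (rrow v) (yrow v)"

definition u_value :: "(ups_coord \<Rightarrow> 'r::comm_ring_1) \<Rightarrow> 'r" where
  "u_value v = - v Z * (v P1)^2 + v P1 * rhead v + (v P3)^2 - disc (rrow v)"

lemma Upsilon14_iff:
  assumes "complex_algebra \<iota>"
  shows "v \<in> Upsilon14 \<iota> \<longleftrightarrow>
    p1_value v = 0 \<and> p24_value (v P2) (v T1) (trow v) v = 0 \<and> p3_value v = 0 \<and>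
    p24_value (v P4) (v S1) (srow v) v = 0 \<and> x_value v = 0 \<and> y_value v = 0 \<and> u_value v = 0"
proof -
  note hom = unital_ring_hom_simps[OF unital_ring_hom_peval[OF assms]] peval_pvar[OF assms]
  note vals = row_defs rrow_def rhead_def bilin_def jacob_def hamil_def disc_def area_def
  have "peval \<iota> v p1_sharp = p1_value v"
    by (simp add: p1_sharp_def p1_value_def hom vals) (simp add: algebra_simps power2_eq_square)
  moreover have "peval \<iota> v p2_sharp = p24_value (v P2) (v T1) (trow v) v"
    by (simp add: p2_sharp_def p24_value_def hom vals) (simp add: algebra_simps power2_eq_square)
  moreover have "peval \<iota> v p3_sharp = p3_value v"
    by (simp add: p3_sharp_def p3_value_def hom vals) (simp add: algebra_simps power2_eq_square)
  moreover have "peval \<iota> v p4_sharp = p24_value (v P4) (v S1) (srow v) v"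
    by (simp add: p4_sharp_def p24_value_def hom vals) (simp add: algebra_simps power2_eq_square)
  moreover have "peval \<iota> v x1_sharp = x_value v $ 1" "peval \<iota> v x2_sharp = x_value v $ 2"
    by (simp_all add: x1_sharp_def x2_sharp_def x_value_def hom vals algebra_simps)
  moreover have "peval \<iota> v y1_sharp = y_value v $ 1" "peval \<iota> v y2_sharp = y_value v $ 2"
    by (simp_all add: y1_sharp_def y2_sharp_def y_value_def hom vals algebra_simps)
  moreover have "peval \<iota> v u_sharp = u_value v"
    by (simp add: u_sharp_def u_value_def hom vals)
  ultimately show ?thesis
    by (simp add: Upsilon14_def vec_eq_iff forall_2)
qed

section \<open>The two transformation rules preserve the equations\<close>

lemma point_eqI:
  assumes "\<And>c. c \<in> {U, Z, S1, T1, P1, P2, P3, P4} \<Longrightarrow> v c = w c"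
    and "xrow v = xrow w" "yrow v = yrow w" "srow v = srow w" "trow v = trow w"
  shows "v = w"
proof
  fix c
  show "v c = w c"
    using assms by (cases c) (auto simp: row_defs vec_eq_iff forall_2 forall_3)
qed

lemma first_rule_scalars:
  "first_rule g v U = v U" "first_rule g v Z = v Z"
  "first_rule g v S1 = v S1" "first_rule g v T1 = v T1"
  "first_rule g v P1 = det g * v P1" "first_rule g v P2 = det g * v P2"
  "first_rule g v P3 = det g * v P3" "first_rule g v P4 = det g * v P4"
  by (simp_all add: first_rule_def Let_def)

lemma first_rule_rows:
  "xrow (first_rule g v) = xrow v v* g" "yrow (first_rule g v) = yrow v v* g"
  "srow (first_rule g v) = srow v v* ghat g" "trow (first_rule g v) = trow v v* ghat g"
  by (simp_all add: vec_eq_iff forall_2 forall_3 row_defs first_rule_def Let_def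
      matrix_matrix_mult_def vector_matrix_mult_def)

lemma vector_4:
  "(vector [a, b, c, d] :: 'a::zero^4) $ 1 = a" "(vector [a, b, c, d] :: 'a^4) $ 2 = b"
  "(vector [a, b, c, d] :: 'a^4) $ 3 = c" "(vector [a, b, c, d] :: 'a^4) $ 4 = d"
  by (simp_all add: vector_def)

lemma second_rule_scalars:
  "second_rule h v U = v U" "second_rule h v Z = v Z"
  "second_rule h v T1 = h$1$1 * v T1 + h$1$2 * v S1" "second_rule h v S1 = h$2$1 * v T1 + h$2$2 * v S1"
  "second_rule h v P2 = h$1$1 * v P2 + h$1$2 * v P4" "second_rule h v P4 = h$2$1 * v P2 + h$2$2 * v P4"
  "second_rule h v P1 = det h * v P1" "second_rule h v P3 = det h * v P3"
  by (simp_all add: second_rule_def Let_def matrix_matrix_mult_def matrix_vector_mult_def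
      sum_2 vector_4)

lemma second_rule_rows:
  "xrow (second_rule h v) = xrow v" "yrow (second_rule h v) = yrow v"
  "trow (second_rule h v) = h$1$1 *s trow v + h$1$2 *s srow v"
  "srow (second_rule h v) = h$2$1 *s trow v + h$2$2 *s srow v"
  by (simp_all add: vec_eq_iff forall_2 forall_3 row_defs second_rule_def Let_def
      matrix_matrix_mult_def sum_2 vector_4)

lemmas rule_simps = first_rule_scalars first_rule_rows second_rule_scalars second_rule_rows

lemma scale_row_mult: "(c *s a) v* A = c *s (a v* A)" for A :: "'r::comm_ring_1^'m^'n"
  by (simp add: vec_eq_iff vector_matrix_mult_def sum_distrib_left mult.assoc)

lemma hamil_scale: "hamil (c *s q) a = c *s hamil q a"
  by (simp add: vec_eq_iff forall_2 hamil_def algebra_simps)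

lemma disc_scale: "disc (c *s q) = c^2 * disc q"
  by (simp add: disc_def algebra_simps power2_eq_square)

lemma bilin_combination: "bilin (c *s q + d *s r) a b = c * bilin q a b + d * bilin r a b"
  by (simp add: bilin_def algebra_simps)

text \<open>
  The forms are listed as \<open>(t, s)\<close> in the rule but as \<open>(s, t)\<close> in the Jacobian. Both arguments are
  therefore combined in swapped order, and the factor is \<open>det h\<close> with its correct sign.
\<close>
lemma jacob_combination:
  "jacob (c *s r + d *s q) (a *s r + b *s q) x = (a * d - b * c) * jacob q r x"
  by (simp add: jacob_def algebra_simps)

lemma first_rule_r:
  "rrow (first_rule g v) = det g *s (rrow v v* ghat g)" "rhead (first_rule g v) = det g * rhead v"
  by (simp_all add: rrow_def rhead_def rule_simps vector_matrix_mult_diff_distrib scale_row_mult)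
     (simp_all add: vec_eq_iff algebra_simps)

lemma second_rule_r:
  "rrow (second_rule h v) = det h *s rrow v" "rhead (second_rule h v) = det h * rhead v"
  by (simp_all add: rrow_def rhead_def rule_simps det_2 vec_eq_iff algebra_simps)

text \<open>
  In the second law the arguments \<open>p\<close>, \<open>q1\<close>, \<open>q\<close> are free, and so it covers the equations for
  \<open>p\<^sub>2\<close> and for \<open>p\<^sub>4\<close> alike: \<open>first_rule g\<close> sends \<open>(p\<^sub>2, t\<^sub>1, t)\<close> and \<open>(p\<^sub>4, s\<^sub>1, s)\<close> to such arguments.
\<close>
lemma first_rule_values:
  assumes "invertible g"
  shows "p1_value (first_rule g v) = det g * p1_value v"
    "p24_value (det g * p) q1 (q v* ghat g) (first_rule g v) = det g * p24_value p q1 q v"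
    "p3_value (first_rule g v) = det g * p3_value v"
    "x_value (first_rule g v) = det g *s (x_value v v* g)"
    "y_value (first_rule g v) = det g *s (y_value v v* g)"
    "u_value (first_rule g v) = (det g)^2 * u_value v"
proof -
  note covariance = bilin_ghat[OF assms] jacob_ghat[OF assms] hamil_ghat[OF assms]
    disc_ghat[OF assms] area_mult hamil_scale disc_scale
  note linear = vector_matrix_left_distrib[symmetric]
  show "p1_value (first_rule g v) = det g * p1_value v"
    by (simp add: p1_value_def rule_simps covariance linear del: vector_matrix_left_distrib)
       (simp add: algebra_simps)
  show "p24_value (det g * p) q1 (q v* ghat g) (first_rule g v) = det g * p24_value p q1 q v"
    by (simp add: p24_value_def rule_simps covariance) (simp add: algebra_simps)
  show "p3_value (first_rule g v) = det g * p3_value v"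
    by (simp add: p3_value_def rule_simps covariance) (simp add: algebra_simps)
  show "x_value (first_rule g v) = det g *s (x_value v v* g)"
    by (simp add: x_value_def rule_simps first_rule_r covariance
        vector_matrix_mult_diff_distrib scale_row_mult)
  show "y_value (first_rule g v) = det g *s (y_value v v* g)"
    by (simp add: y_value_def rule_simps first_rule_r covariance
        vector_matrix_mult_diff_distrib scale_row_mult) (simp add: vec_eq_iff algebra_simps)
  show "u_value (first_rule g v) = (det g)^2 * u_value v"
    by (simp add: u_value_def rule_simps first_rule_r covariance algebra_simps power2_eq_square)
qed

text \<open>
  The second law, with \<open>(c, d)\<close> equal to either row of \<open>h\<close>, describes the action of \<open>h\<close> on the column
  of the equations for \<open>p\<^sub>2\<close> and \<open>p\<^sub>4\<close>.
\<close>
lemma second_rule_values: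
  "p1_value (second_rule h v) = det h * p1_value v"
  "p24_value (c * p + d * p') (c * q1 + d * q1') (c *s q + d *s q') (second_rule h v)
     = c * p24_value p q1 q v + d * p24_value p' q1' q' v"
  "p3_value (second_rule h v) = det h * p3_value v"
  "x_value (second_rule h v) = det h *s x_value v"
  "y_value (second_rule h v) = det h *s y_value v"
  "u_value (second_rule h v) = (det h)^2 * u_value v"
proof -
  note covariance = bilin_combination jacob_combination hamil_scale disc_scale
  show "p1_value (second_rule h v) = det h * p1_value v"
    by (simp add: p1_value_def rule_simps covariance det_2) (simp add: algebra_simps)
  show "p24_value (c * p + d * p') (c * q1 + d * q1') (c *s q + d *s q') (second_rule h v)
      = c * p24_value p q1 q v + d * p24_value p' q1' q' v"
    by (simp add: p24_value_def rule_simps covariance) (simp add: algebra_simps)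
  show "p3_value (second_rule h v) = det h * p3_value v"
    by (simp add: p3_value_def rule_simps covariance det_2) (simp add: algebra_simps)
  show "x_value (second_rule h v) = det h *s x_value v"
    by (simp add: x_value_def rule_simps second_rule_r covariance)
  show "y_value (second_rule h v) = det h *s y_value v"
    by (simp add: y_value_def rule_simps second_rule_r covariance) (simp add: vec_eq_iff algebra_simps)
  show "u_value (second_rule h v) = (det h)^2 * u_value v"
    by (simp add: u_value_def rule_simps second_rule_r covariance algebra_simps power2_eq_square)
qed

lemma first_rule_Upsilon14:
  assumes "complex_algebra \<iota>" "invertible g" "v \<in> Upsilon14 \<iota>"
  shows "first_rule g v \<in> Upsilon14 \<iota>"
  using assms(3) unfolding Upsilon14_iff[OF assms(1)]
  by (simp add: first_rule_values[OF assms(2)] first_rule_rows first_rule_scalars)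

lemma second_rule_Upsilon14:
  assumes "complex_algebra \<iota>" "v \<in> Upsilon14 \<iota>"
  shows "second_rule h v \<in> Upsilon14 \<iota>"
  using assms(2) unfolding Upsilon14_iff[OF assms(1)]
  by (simp add: second_rule_values second_rule_rows second_rule_scalars)

section \<open>The group laws\<close>

lemma first_rule_mult:
  assumes "invertible g" "invertible g'"
  shows "first_rule (g ** g') v = first_rule g' (first_rule g v)"
  by (rule point_eqI)
     (auto simp: rule_simps det_mul vector_matrix_mul_assoc ghat_mult[OF assms] mult_ac)

lemma first_rule_one: "first_rule (mat 1) v = v"
  by (rule point_eqI) (auto simp: rule_simps ghat_one)

lemma matrix_mult_2: "(A ** (B :: 'r::comm_ring_1^'m^2)) $ i $ j = A$i$1 * B$1$j + A$i$2 * B$2$j"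
  by (simp add: matrix_matrix_mult_def sum_2)

lemma second_rule_mult: "second_rule (h ** h') v = second_rule h (second_rule h' v)"
  by (rule point_eqI)
     (auto simp: rule_simps det_mul matrix_mult_2 vec_eq_iff algebra_simps)

lemma second_rule_one: "second_rule (mat 1) v = v"
  by (rule point_eqI) (auto simp: rule_simps det_I vec_eq_iff, simp_all add: mat_def)

text \<open>
  The second factor mixes the rows of the matrix of \<open>t\<close> and \<open>s\<close>, while the first mixes its last three
  columns.
\<close>
lemma rules_commute: "first_rule g (second_rule h v) = second_rule h (first_rule g v)"
  by (rule point_eqI)
     (auto simp: rule_simps vector_matrix_left_distrib scale_row_mult algebra_simps)

lemma group_GL2: "group (GL2 :: ('r::comm_ring_1^2^2) monoid)"
proof (rule groupI)
  fix x :: "'r^2^2"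
  assume "x \<in> carrier GL2"
  then show "\<exists>y\<in>carrier GL2. y \<otimes>\<^bsub>GL2\<^esub> x = \<one>\<^bsub>GL2\<^esub>"
    by (auto simp: GL2_def invertible_def)
qed (auto simp: GL2_def invertible_mult matrix_mul_assoc invertible_def[of "mat 1"])

text \<open>
  Each \<open>act g\<close> is a bijection of \<open>E\<close> because \<open>act\<close> of the inverse element undoes it; so the usual
  axioms of an action suffice for a homomorphism into the group of bijections.
\<close>
lemma group_actionI:
  assumes "group G"
    and closed: "\<And>g x. g \<in> carrier G \<Longrightarrow> x \<in> E \<Longrightarrow> act g x \<in> E"
    and one: "\<And>x. x \<in> E \<Longrightarrow> act \<one>\<^bsub>G\<^esub> x = x"
    and mult: "\<And>g h x. g \<in> carrier G \<Longrightarrow> h \<in> carrier G \<Longrightarrow> x \<in> E \<Longrightarrow> act (g \<otimes>\<^bsub>G\<^esub> h) x = act g (act h x)"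
  shows "group_action G E (\<lambda>g. \<lambda>x\<in>E. act g x)"
proof -
  interpret group G by fact
  have bij: "restrict (act g) E \<in> Bij E" if g: "g \<in> carrier G" for g
  proof -
    have "bij_betw (act g) E E"
    proof (rule bij_betw_byWitness)
      show "\<forall>x\<in>E. act (inv\<^bsub>G\<^esub> g) (act g x) = x" "\<forall>x\<in>E. act g (act (inv\<^bsub>G\<^esub> g) x) = x"
        using g by (simp_all add: mult[symmetric] one)
    qed (use g closed in auto)
    then show ?thesis
      by (simp add: Bij_def bij_betw_restrict_eq)
  qed
  have "(\<lambda>g. restrict (act g) E) \<in> hom G (BijGroup E)"
  proof (rule homI)
    show "restrict (act g) E \<in> carrier (BijGroup E)" if "g \<in> carrier G" for g
      using bij[OF that] by (simp add: BijGroup_def)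
    show "restrict (act (g \<otimes>\<^bsub>G\<^esub> h)) E = restrict (act g) E \<otimes>\<^bsub>BijGroup E\<^esub> restrict (act h) E"
      if "g \<in> carrier G" "h \<in> carrier G" for g h
      using that by (auto simp: BijGroup_def bij compose_def mult closed fun_eq_iff)
  qed
  then show ?thesis
    by (intro group_action.intro group_hom.intro group_hom_axioms.intro group_BijGroup assms(1))
qed

lemma ups_act_Upsilon14:
  assumes "complex_algebra \<iota>" "g \<in> carrier GL2" "v \<in> Upsilon14 \<iota>"
  shows "ups_act (g, h) v \<in> Upsilon14 \<iota>"
proof -
  have "invertible (inv\<^bsub>GL2\<^esub> g)"
    using group.inv_closed[OF group_GL2 assms(2)] by (simp add: GL2_def)
  then show ?thesis
    using assms by (simp add: ups_act_def first_rule_Upsilon14 second_rule_Upsilon14)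
qed

text \<open>
  Inversion in the first factor reverses products, and \<open>first_rule\<close> reverses them once more. The
  commutation of the two rules then brings the four steps into the order required.
\<close>
lemma ups_act_mult:
  assumes "g \<in> carrier GL2" "g' \<in> carrier GL2"
  shows "ups_act (g ** g', h ** h') v = ups_act (g, h) (ups_act (g', h') v)"
proof -
  have inv: "invertible (inv\<^bsub>GL2\<^esub> g)" "invertible (inv\<^bsub>GL2\<^esub> g')"
    using assms[THEN group.inv_closed[OF group_GL2]] by (simp_all add: GL2_def)
  have "inv\<^bsub>GL2\<^esub> (g ** g') = inv\<^bsub>GL2\<^esub> g' ** inv\<^bsub>GL2\<^esub> g"
    using group.inv_mult_group[OF group_GL2 assms] by (simp add: GL2_def)
  then show ?thesis
    by (simp add: ups_act_def first_rule_mult inv second_rule_mult rules_commute)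
qed

lemma group_action_ups_act:
  fixes \<iota> :: "complex \<Rightarrow> 'r::comm_ring_1"
  assumes "complex_algebra \<iota>"
  shows "group_action (GL2 \<times>\<times> GL2) (Upsilon14 \<iota>) (\<lambda>gh. \<lambda>v\<in>Upsilon14 \<iota>. ups_act gh v)"
proof (rule group_actionI)
  show "group ((GL2 :: ('r^2^2) monoid) \<times>\<times> (GL2 :: ('r^2^2) monoid))"
    by (intro DirProd_group group_GL2)
  show "ups_act gh v \<in> Upsilon14 \<iota>"
    if "gh \<in> carrier (GL2 \<times>\<times> GL2)" "v \<in> Upsilon14 \<iota>" for gh v
    using that assms by (cases gh) (auto intro: ups_act_Upsilon14)
  show "ups_act \<one>\<^bsub>GL2 \<times>\<times> GL2\<^esub> v = v" for v :: "ups_coord \<Rightarrow> 'r"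
  proof -
    have "inv\<^bsub>GL2\<^esub> (mat 1 :: 'r^2^2) = mat 1"
      using group.is_monoid[OF group_GL2, THEN monoid.inv_one] by (simp add: GL2_def)
    then show ?thesis
      by (simp add: ups_act_def first_rule_one second_rule_one) (simp add: GL2_def first_rule_one second_rule_one)
  qed
  show "ups_act (gh \<otimes>\<^bsub>GL2 \<times>\<times> GL2\<^esub> gh') v = ups_act gh (ups_act gh' v)"
    if "gh \<in> carrier (GL2 \<times>\<times> GL2)" "gh' \<in> carrier (GL2 \<times>\<times> GL2)"
    for gh gh' and v :: "ups_coord \<Rightarrow> 'r"
    using that ups_act_mult[of "fst gh" "fst gh'" "snd gh" "snd gh'" v]
    by (cases gh, cases gh') (simp add: GL2_def)
qed

section \<open>Compatibility with algebra homomorphisms\<close>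

context
  fixes \<phi> :: "'r::comm_ring_1 \<Rightarrow> 's::comm_ring_1"
  assumes \<phi>: "unital_ring_hom \<phi>"
begin

lemmas \<phi>_simps = unital_ring_hom_simps[OF \<phi>]

lemma map_matrix_mult: "map_matrix \<phi> (A ** B) = map_matrix \<phi> A ** map_matrix \<phi> B"
  by (simp add: vec_eq_iff matrix_matrix_mult_def unital_ring_hom_sum[OF \<phi>] \<phi>_simps)

lemma map_matrix_one: "map_matrix \<phi> (mat 1) = mat 1"
  by (simp add: vec_eq_iff mat_def \<phi>_simps)

lemma map_matrix_det: "det (map_matrix \<phi> g) = \<phi> (det g)" for g :: "'r^2^2"
  by (simp add: det_2 \<phi>_simps)

lemma map_matrix_invertible: "invertible (map_matrix \<phi> g)" if "invertible g"
  using that unfolding invertible_def by (metis map_matrix_mult map_matrix_one)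

lemma group_hom_map_matrix: "group_hom GL2 GL2 (map_matrix \<phi>)"
  by (intro group_hom.intro group_hom_axioms.intro group_GL2 homI)
     (simp_all add: GL2_def map_matrix_mult map_matrix_invertible)

text \<open>
  A homomorphism maps units to units and their inverses to inverses; this is the point at which the
  naturality of \<open>ghat\<close>, otherwise polynomial in the entries, needs \<open>g\<close> to be invertible.
\<close>
lemma map_matrix_ghat: "map_matrix \<phi> (ghat g) = ghat (map_matrix \<phi> g)" if "invertible g"
proof -
  have "det (map_matrix \<phi> g) * \<phi> (unit_inverse (det g)) = 1"
    using arg_cong[OF det_unit[OF that], of \<phi>] by (simp add: map_matrix_det \<phi>_simps)
  then have "unit_inverse (det (map_matrix \<phi> g)) = \<phi> (unit_inverse (det g))"
    by (rule unit_inverse_eq)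
  then show ?thesis
    by (simp add: vec_eq_iff forall_3 ghat_def Let_def \<phi>_simps)
qed

lemma first_rule_hom:
  assumes "invertible g"
  shows "\<phi> \<circ> first_rule g v = first_rule (map_matrix \<phi> g) (\<phi> \<circ> v)"
proof (rule ext)
  fix c
  show "(\<phi> \<circ> first_rule g v) c = first_rule (map_matrix \<phi> g) (\<phi> \<circ> v) c"
    by (cases c) (simp_all add: first_rule_def Let_def map_matrix_ghat[OF assms, symmetric]
        map_matrix_det matrix_matrix_mult_def sum_2 sum_3 \<phi>_simps)
qed

lemma second_rule_hom: "\<phi> \<circ> second_rule h v = second_rule (map_matrix \<phi> h) (\<phi> \<circ> v)"
proof (rule ext)
  fix c
  show "(\<phi> \<circ> second_rule h v) c = second_rule (map_matrix \<phi> h) (\<phi> \<circ> v) c"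
    by (cases c) (simp_all add: second_rule_def Let_def map_matrix_det
        matrix_matrix_mult_def matrix_vector_mult_def sum_2 vector_4 \<phi>_simps)
qed

lemma ups_act_hom:
  assumes "g \<in> carrier GL2"
  shows "\<phi> \<circ> ups_act (g, h) v = ups_act (map_matrix \<phi> g, map_matrix \<phi> h) (\<phi> \<circ> v)"
proof -
  have "invertible (inv\<^bsub>GL2\<^esub> g)"
    using group.inv_closed[OF group_GL2 assms] by (simp add: GL2_def)
  moreover have "map_matrix \<phi> (inv\<^bsub>GL2\<^esub> g) = inv\<^bsub>GL2\<^esub> (map_matrix \<phi> g)"
    using group_hom.hom_inv[OF group_hom_map_matrix assms] .
  ultimately show ?thesis
    by (simp add: ups_act_def second_rule_hom first_rule_hom)
qed

end

theorem proposition3p3: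
  fixes \<iota> :: "complex \<Rightarrow> 'r::comm_ring_1"
  assumes "complex_algebra \<iota>"
  shows "group_action ((GL2 :: ('r^2^2) monoid) \<times>\<times> (GL2 :: ('r^2^2) monoid)) (Upsilon14 \<iota>)
           (\<lambda>gh. \<lambda>v\<in>Upsilon14 \<iota>. ups_act gh v)
       \<and> (\<forall>(\<kappa> :: complex \<Rightarrow> 's::comm_ring_1) \<phi>.
            complex_algebra \<kappa> \<longrightarrow> complex_algebra_hom \<iota> \<kappa> \<phi> \<longrightarrow>
            (\<forall>g\<in>carrier GL2. \<forall>h\<in>carrier GL2. \<forall>v\<in>Upsilon14 \<iota>.
               map_matrix \<phi> g \<in> carrier GL2 \<and> map_matrix \<phi> h \<in> carrier GL2 \<and>
               \<phi> \<circ> v \<in> Upsilon14 \<kappa> \<and>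
               \<phi> \<circ> ups_act (g, h) v = ups_act (map_matrix \<phi> g, map_matrix \<phi> h) (\<phi> \<circ> v)))"
proof (intro conjI allI impI ballI)
  show "group_action ((GL2 :: ('r^2^2) monoid) \<times>\<times> (GL2 :: ('r^2^2) monoid)) (Upsilon14 \<iota>)
      (\<lambda>gh. \<lambda>v\<in>Upsilon14 \<iota>. ups_act gh v)"
    by (rule group_action_ups_act[OF assms])
next
  fix \<kappa> :: "complex \<Rightarrow> 's" and \<phi> and g h :: "'r^2^2" and v :: "ups_coord \<Rightarrow> 'r"
  assume hom: "complex_algebra_hom \<iota> \<kappa> \<phi>"
    and g: "g \<in> carrier GL2" and h: "h \<in> carrier GL2" and v: "v \<in> Upsilon14 \<iota>"
  have \<phi>: "unital_ring_hom \<phi>"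
    using hom by (simp add: complex_algebra_hom_def)
  show "map_matrix \<phi> g \<in> carrier GL2" "map_matrix \<phi> h \<in> carrier GL2"
    using group_hom.hom_closed[OF group_hom_map_matrix[OF \<phi>]] g h by blast+
  show "\<phi> \<circ> v \<in> Upsilon14 \<kappa>"
    using v by (simp add: Upsilon14_def peval_hom[OF hom, symmetric] unital_ring_hom_simps[OF \<phi>])
  show "\<phi> \<circ> ups_act (g, h) v = ups_act (map_matrix \<phi> g, map_matrix \<phi> h) (\<phi> \<circ> v)"
    by (rule ups_act_hom[OF \<phi> g])
qed

end
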